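(* Let $G_1$ and $G_2$ be two $A$-cospectral $r_1$-regular graphs with $n$ vertices and $m$ edges, and let $H_1,\ldots,H_m$ be $r_2$-regular graphs, each of the same order $q$. Then for any real $\alpha\in[0,1]$, the generalized edge coronas $G_1[H_i]_1^m$ and $G_2[H_i]_1^m$ are $A_\alpha$-cospectral.
   Context: All graphs are finite, simple and undirected. For a graph $G$ with adjacency matrix $A(G)$ and diagonal degree matrix $D(G)$, and real $\alpha\in[0,1]$, $A_\alpha(G)=\alpha D(G)+(1-\alpha)A(G)$. Two non-isomorphic graphs are said to be $A$-cospectral (respectively $A_\alpha$-cospectral) if their adjacency matrices (respectively their $A_\alpha$-matrices) have the same multiset of eigenvalues. For a graph $G$ with $m$ edges $e_1,\ldots,e_m$ and graphs $H_1,\ldots,H_m$, the generalized edge corona $G[H_i]_1^m$ is the graph obtained by taking one copy of each of $G,H_1,\ldots,H_m$ (pairwise disjoint) and joining both end-vertices of the $i$th edge $e_i$ of $G$ to every vertex of $H_i$, for $1\le i\le m$. *)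

theory Defs
  imports
    Complex_Main
    "HOL-Computational_Algebra.Polynomial"
    "Jordan_Normal_Form.Char_Poly"
begin

section \<open>Finite simple undirected graphs\<close>

record 'a ugraph =
  verts :: "'a set"
  edges :: "'a set set"

definition simple_graph :: "'a ugraph \<Rightarrow> bool" where
  "simple_graph G \<longleftrightarrow> finite (verts G) \<and> (\<forall>e\<in>edges G. e \<subseteq> verts G \<and> card e = 2)"

definition vdegree :: "'a ugraph \<Rightarrow> 'a \<Rightarrow> nat" where
  "vdegree G v = card {e \<in> edges G. v \<in> e}"

definition regular_graph :: "nat \<Rightarrow> 'a ugraph \<Rightarrow> bool" where
  "regular_graph r G \<longleftrightarrow> (\<forall>v\<in>verts G. vdegree G v = r)"

definition graph_isomorphic :: "'a ugraph \<Rightarrow> 'b ugraph \<Rightarrow> bool" where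
  "graph_isomorphic G H \<longleftrightarrow>
     (\<exists>f. bij_betw f (verts G) (verts H) \<and>
        (\<forall>u\<in>verts G. \<forall>v\<in>verts G. {u, v} \<in> edges G \<longleftrightarrow> {f u, f v} \<in> edges H))"


section \<open>Graph matrices and their eigenvalues\<close>

text \<open>Rows and columns are indexed by the positions in a list \<open>vs\<close> that enumerates the
  vertices without repetition.\<close>

definition adj_mat :: "'a list \<Rightarrow> 'a ugraph \<Rightarrow> real mat" where
  "adj_mat vs G = mat (length vs) (length vs)
     (\<lambda>(i, j). if {vs ! i, vs ! j} \<in> edges G then 1 else 0)"

definition deg_mat :: "'a list \<Rightarrow> 'a ugraph \<Rightarrow> real mat" where
  "deg_mat vs G = mat (length vs) (length vs)
     (\<lambda>(i, j). if i = j then real (vdegree G (vs ! i)) else 0)"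

definition A_alpha_mat :: "real \<Rightarrow> 'a list \<Rightarrow> 'a ugraph \<Rightarrow> real mat" where
  "A_alpha_mat \<alpha> vs G = \<alpha> \<cdot>\<^sub>m deg_mat vs G + (1 - \<alpha>) \<cdot>\<^sub>m adj_mat vs G"

text \<open>Eigenvalues are counted with algebraic multiplicity, over the complex numbers (for the
  symmetric matrices above they are all real).\<close>

definition eigenvalue_mset :: "real mat \<Rightarrow> complex multiset" where
  "eigenvalue_mset M = proots (char_poly (map_mat complex_of_real M))"

text \<open>An arbitrary but fixed enumeration of the vertices is used; the lemmas
  \<open>A_spectrum_listing\<close> and \<open>A_alpha_spectrum_listing\<close> below show that the choice is irrelevant.\<close>

definition vertex_list :: "'a ugraph \<Rightarrow> 'a list" where
  "vertex_list G = (SOME vs. distinct vs \<and> set vs = verts G)"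

definition A_spectrum :: "'a ugraph \<Rightarrow> complex multiset" where
  "A_spectrum G = eigenvalue_mset (adj_mat (vertex_list G) G)"

definition A_alpha_spectrum :: "real \<Rightarrow> 'a ugraph \<Rightarrow> complex multiset" where
  "A_alpha_spectrum \<alpha> G = eigenvalue_mset (A_alpha_mat \<alpha> (vertex_list G) G)"

text \<open>Cospectrality is a relation between non-isomorphic graphs.\<close>

definition A_cospectral :: "'a ugraph \<Rightarrow> 'b ugraph \<Rightarrow> bool" where
  "A_cospectral G H \<longleftrightarrow> \<not> graph_isomorphic G H \<and> A_spectrum G = A_spectrum H"

definition A_alpha_cospectral :: "real \<Rightarrow> 'a ugraph \<Rightarrow> 'b ugraph \<Rightarrow> bool" where
  "A_alpha_cospectral \<alpha> G H \<longleftrightarrow>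
     \<not> graph_isomorphic G H \<and> A_alpha_spectrum \<alpha> G = A_alpha_spectrum \<alpha> H"


section \<open>Generalized edge corona\<close>

text \<open>The edges of \<open>G\<close> are enumerated as \<open>e 1, \<dots>, e m\<close>. Vertices of \<open>G\<close> are tagged \<open>Inl\<close>,
  and a vertex \<open>x\<close> of the \<open>i\<close>-th graph \<open>H i\<close> becomes \<open>Inr (i, x)\<close>, so that the copies are
  pairwise disjoint.\<close>

definition gen_edge_corona ::
  "'a ugraph \<Rightarrow> nat \<Rightarrow> (nat \<Rightarrow> 'a set) \<Rightarrow> (nat \<Rightarrow> 'b ugraph) \<Rightarrow> ('a + nat \<times> 'b) ugraph" where
  "gen_edge_corona G m e H =
     \<lparr> verts = verts G <+> (SIGMA i:{1..m}. verts (H i)),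
       edges = {Inl ` d | d. d \<in> edges G}
             \<union> {(\<lambda>x. Inr (i, x)) ` d | i d. i \<in> {1..m} \<and> d \<in> edges (H i)}
             \<union> {{Inl u, Inr (i, x)} | i u x. i \<in> {1..m} \<and> u \<in> e i \<and> x \<in> verts (H i)} \<rparr>"


section \<open>Sanity checks\<close>

lemma char_poly_listing:
  fixes g :: "'a \<Rightarrow> 'a \<Rightarrow> 'b :: field"
  assumes "distinct vs" "distinct ws" "set vs = set ws"
  shows "char_poly (mat (length vs) (length vs) (\<lambda>(i, j). g (vs ! i) (vs ! j))) =
         char_poly (mat (length ws) (length ws) (\<lambda>(i, j). g (ws ! i) (ws ! j)))"
proof -
  define n where "n = length ws"
  have len: "length vs = n"
    using assms distinct_card n_def by metis
  have "mset vs = mset ws"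
    using assms by (simp add: set_eq_iff_mset_eq_distinct)
  then obtain p where p: "p permutes {..<n}" and perm: "permute_list p ws = vs"
    unfolding n_def by (rule mset_eq_permutation)
  have pi: "p i < n" if "i < n" for i
    using permutes_in_image[OF p] that by simp
  have nth: "vs ! i = ws ! p i" if "i < n" for i
    using that p perm permute_list_nth[of p ws i] unfolding n_def by auto
  have inj: "p i = p j \<longleftrightarrow> i = j" for i j
    using permutes_inj[OF p] by (auto dest: injD)
  define A where "A = mat n n (\<lambda>(i, j). g (vs ! i) (vs ! j))"
  define B where "B = mat n n (\<lambda>(i, j). g (ws ! i) (ws ! j))"
  define P :: "'b mat" where "P = mat n n (\<lambda>(i, j). if j = p i then 1 else 0)"
  define Q :: "'b mat" where "Q = mat n n (\<lambda>(i, j). if i = p j then 1 else 0)"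
  have carr: "A \<in> carrier_mat n n" "B \<in> carrier_mat n n"
    "P \<in> carrier_mat n n" "Q \<in> carrier_mat n n"
    by (auto simp: A_def B_def P_def Q_def)
  have PQ: "P * Q = 1\<^sub>m n"
    by (rule eq_matI)
      (auto simp: P_def Q_def scalar_prod_def pi inj if_distrib[of "\<lambda>x. x * _"] sum.delta cong: if_cong)
  have QP: "Q * P = 1\<^sub>m n"
    using mat_mult_left_right_inverse[OF carr(3,4) PQ] .
  have PB: "P * B = mat n n (\<lambda>(i, j). g (ws ! p i) (ws ! j))"
    by (rule eq_matI)
      (auto simp: P_def B_def scalar_prod_def pi if_distrib[of "\<lambda>x. x * _"] sum.delta cong: if_cong)
  have "A = P * B * Q"
    unfolding PB
    by (rule eq_matI)
      (auto simp: A_def Q_def scalar_prod_def pi nth if_distrib[of "\<lambda>x. _ * x"] sum.delta cong: if_cong)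
  then have "similar_mat A B"
    using carr PQ QP by (intro similar_matI[of A B P Q n]) auto
  then show ?thesis
    using char_poly_similar by (simp add: A_def B_def len n_def)
qed

lemma vertex_list:
  assumes "finite (verts G)"
  shows "distinct (vertex_list G)" "set (vertex_list G) = verts G"
proof -
  have "\<exists>vs. distinct vs \<and> set vs = verts G"
    using finite_distinct_list[OF assms] by blast
  then show "distinct (vertex_list G)" "set (vertex_list G) = verts G"
    unfolding vertex_list_def by (metis (mono_tags, lifting) someI_ex)+
qed

lemma A_alpha_spectrum_listing:
  assumes "simple_graph G" "distinct vs" "set vs = verts G"
  shows "A_alpha_spectrum \<alpha> G = eigenvalue_mset (A_alpha_mat \<alpha> vs G)"
proof -
  define g where "g = (\<lambda>u v. complex_of_real
    (\<alpha> * (if u = v then real (vdegree G u) else 0) + (1 - \<alpha>) * (if {u, v} \<in> edges G then 1 else 0)))"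
  have eq: "map_mat complex_of_real (A_alpha_mat \<alpha> us G) =
      mat (length us) (length us) (\<lambda>(i, j). g (us ! i) (us ! j))" if "distinct us" for us
    by (rule eq_matI)
      (use that in \<open>auto simp: A_alpha_mat_def deg_mat_def adj_mat_def g_def nth_eq_iff_index_eq\<close>)
  have fin: "finite (verts G)"
    using assms(1) by (simp add: simple_graph_def)
  show ?thesis
    unfolding A_alpha_spectrum_def eigenvalue_mset_def
      eq[OF vertex_list(1)[OF fin]] eq[OF assms(2)]
    using char_poly_listing[OF vertex_list(1)[OF fin] assms(2), of g] vertex_list(2)[OF fin] assms(3)
    by simp
qed

lemma A_spectrum_eq_A_alpha_spectrum: "A_spectrum G = A_alpha_spectrum 0 G"
proof -
  have "A_alpha_mat 0 vs G = adj_mat vs G" for vs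
    by (rule eq_matI) (auto simp: A_alpha_mat_def deg_mat_def adj_mat_def)
  then show ?thesis
    by (simp add: A_spectrum_def A_alpha_spectrum_def)
qed

lemma A_spectrum_listing:
  assumes "simple_graph G" "distinct vs" "set vs = verts G"
  shows "A_spectrum G = eigenvalue_mset (adj_mat vs G)"
proof -
  have "A_alpha_mat 0 vs G = adj_mat vs G"
    by (rule eq_matI) (auto simp: A_alpha_mat_def deg_mat_def adj_mat_def)
  then show ?thesis
    using A_alpha_spectrum_listing[OF assms, of 0] by (simp add: A_spectrum_eq_A_alpha_spectrum)
qed

lemma simple_graph_gen_edge_corona:
  assumes "simple_graph G" "bij_betw e {1..m} (edges G)"
    and "\<And>i. i \<in> {1..m} \<Longrightarrow> simple_graph (H i)"
  shows "simple_graph (gen_edge_corona G m e H)"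
proof -
  have e: "e i \<subseteq> verts G" if "i \<in> {1..m}" for i
    using assms(1,2) that bij_betwE by (fastforce simp: simple_graph_def)
  have inj: "inj (\<lambda>x. Inr (i, x))" for i :: nat
    by (rule injI) simp
  have "finite (verts G <+> (SIGMA i:{1..m}. verts (H i)))"
    using assms(1,3) by (auto simp: simple_graph_def)
  moreover have "d \<subseteq> verts (gen_edge_corona G m e H) \<and> card d = 2"
    if "d \<in> edges (gen_edge_corona G m e H)" for d
  proof -
    from that consider
        d' where "d = Inl ` d'" "d' \<in> edges G"
      | i d' where "d = (\<lambda>x. Inr (i, x)) ` d'" "i \<in> {1..m}" "d' \<in> edges (H i)"
      | i u x where "d = {Inl u, Inr (i, x)}" "i \<in> {1..m}" "u \<in> e i" "x \<in> verts (H i)"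
      by (auto simp: gen_edge_corona_def)
    then show ?thesis
    proof cases
      case 1
      then show ?thesis
        using assms(1) by (auto simp: simple_graph_def gen_edge_corona_def card_image)
    next
      case 2
      then show ?thesis
        using assms(3)[OF 2(2)] card_image[OF inj_on_subset[OF inj subset_UNIV], of i d']
        by (auto simp: simple_graph_def gen_edge_corona_def)
    next
      case 3
      then show ?thesis
        using e[OF 3(2)] by (auto simp: gen_edge_corona_def)
    qed
  qed
  ultimately show ?thesis
    by (simp add: simple_graph_def gen_edge_corona_def)
qed

end

theory Submission
  imports Defs "HOL-Library.Disjoint_Sets"
begin

text \<open>
  Order the vertices of a corona with those of the base graph \<open>G\<close> first.  Its \<open>A\<^sub>\<alpha>\<close>-matrix then has
  the block form with upper left block \<open>\<alpha> r (q + 1) I + (1 - \<alpha>) A(G)\<close>, a lower right block \<open>B\<close>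
  built from the graphs \<open>H i\<close> alone, and a lower left block \<open>D\<close> which is \<open>1 - \<alpha>\<close> times the edge-vertex
  incidence matrix of \<open>G\<close> with every row repeated once for each vertex of the copy.  As all \<open>H i\<close> are
  \<open>s\<close>-regular, \<open>B\<close> multiplies every vector that is constant on each copy by
  \<open>c = \<alpha> (s + 2) + (1 - \<alpha>) s\<close>; the columns of \<open>D\<close> are such vectors, so \<open>B D = c D\<close>.  This makes
  block elimination possible without inverting \<open>k I - B\<close> (\<open>char_poly_four_block_mat\<close>).  All copies have
  the same order \<open>q\<close>, so the Schur complement contains \<open>G\<close> only through
  \<open>D\<^sup>T D = (1 - \<alpha>)\<^sup>2 q (A(G) + r I)\<close>, and the characteristic polynomial of the corona at \<open>k \<noteq> c\<close> is
  \<open>det (x I - t A(G)) \<cdot> det (k I - B)\<close> with \<open>x\<close>, \<open>t\<close> depending on \<open>k, \<alpha>, r, s, q\<close> only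
  (\<open>poly_char_poly_corona\<close>).  The first factor is determined by the spectrum of \<open>A(G)\<close>
  (\<open>det_pencil_cong\<close>), and the second one is the same for both base graphs.

  Cospectral graphs are non-isomorphic by definition, so it also has to be shown that the coronas do
  not become isomorphic.  If \<open>r \<ge> 2\<close>, the vertices of \<open>G\<close> have degree \<open>r (q + 1) \<ge> 2 (q + 1)\<close> in the
  corona, whereas those of the copies have degree \<open>s + 2 \<le> q + 1\<close>; an isomorphism of the coronas thus
  restricts to one of the base graphs (\<open>base_isomorphic_if_corona_isomorphic\<close>).  If \<open>r \<le> 1\<close>, the base graphs
  are edgeless or perfect matchings of the same order and already isomorphic
  (\<open>regular_degree_le_1_isomorphic\<close>).
\<close>

section \<open>Characteristic polynomials of block matrices\<close>

lemma poly_char_poly_eq_det: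
  fixes A :: "'a :: comm_ring_1 mat"
  assumes A: "A \<in> carrier_mat n n"
  shows "poly (char_poly A) k = det (k \<cdot>\<^sub>m 1\<^sub>m n - A)"
  unfolding char_poly_def
  by (rule poly_det_cong[of _ n]) (use A in \<open>auto simp: char_poly_matrix_def\<close>)

text \<open>
  A Schur complement formula.  Adding the last block column times \<open>Y = D / (k - c)\<close> to the first one
  clears the lower left block \<open>- D\<close> of the characteristic matrix, because \<open>(k I - B) D = (k - c) D\<close>.
  Thus \<open>k\<close> only has to avoid \<open>c\<close>, not the whole spectrum of \<open>B\<close>.
\<close>

lemma char_poly_four_block_mat:
  fixes A B C D :: "'a :: field mat"
  assumes A: "A \<in> carrier_mat n n" and C: "C \<in> carrier_mat n l"
    and D: "D \<in> carrier_mat l n" and B: "B \<in> carrier_mat l l"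
    and eig: "B * D = c \<cdot>\<^sub>m D" and k: "k \<noteq> c"
  shows "poly (char_poly (four_block_mat A C D B)) k =
    det (k \<cdot>\<^sub>m 1\<^sub>m n - A - (1 / (k - c)) \<cdot>\<^sub>m (C * D)) * poly (char_poly B) k"
proof -
  let ?Y = "(1 / (k - c)) \<cdot>\<^sub>m D"
  let ?A = "k \<cdot>\<^sub>m 1\<^sub>m n - A" and ?B = "k \<cdot>\<^sub>m 1\<^sub>m l - B"
  let ?N = "four_block_mat ?A (- C) (- D) ?B"
  let ?U = "four_block_mat (1\<^sub>m n) (0\<^sub>m n l) ?Y (1\<^sub>m l)"
  have M: "four_block_mat A C D B \<in> carrier_mat (n + l) (n + l)"
    using A B by simp
  have N: "?N \<in> carrier_mat (n + l) (n + l)" and U: "?U \<in> carrier_mat (n + l) (n + l)"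
    using A B by auto
  have kN: "k \<cdot>\<^sub>m 1\<^sub>m (n + l) - four_block_mat A C D B = ?N"
    by (rule eq_matI) (use A B C D in auto)
  have CY: "?A * 1\<^sub>m n + - C * ?Y = ?A - (1 / (k - c)) \<cdot>\<^sub>m (C * D)"
  proof -
    have "- C * ?Y = - ((1 / (k - c)) \<cdot>\<^sub>m (C * D))"
      using C D by (simp add: mult_smult_distrib[OF C D])
    then show ?thesis
      by (intro eq_matI) (use A C D in auto)
  qed
  have BY: "- D * 1\<^sub>m n + ?B * ?Y = 0\<^sub>m l n"
  proof -
    have "?B * ?Y = (k \<cdot>\<^sub>m 1\<^sub>m l) * ?Y - B * ?Y"
      by (rule minus_mult_distrib_mat) (use B D in auto)
    also have "\<dots> = k \<cdot>\<^sub>m ?Y - (1 / (k - c)) \<cdot>\<^sub>m (c \<cdot>\<^sub>m D)"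
      using mult_smult_assoc_mat[of "1\<^sub>m l" l l ?Y n k] mult_smult_distrib[OF B D] D eig by simp
    also have "\<dots> = D"
    proof (rule eq_matI)
      fix i j assume "i < dim_row D" "j < dim_col D"
      moreover have "(k * d - c * d) / (k - c) = d" for d
        using k by (simp add: left_diff_distrib[symmetric])
      ultimately show "(k \<cdot>\<^sub>m ?Y - (1 / (k - c)) \<cdot>\<^sub>m (c \<cdot>\<^sub>m D)) $$ (i, j) = D $$ (i, j)"
        by (simp add: diff_divide_distrib)
    qed (use D in auto)
    finally show ?thesis
      by (intro eq_matI) (use D in auto)
  qed
  have NU: "?N * ?U = four_block_mat (?A - (1 / (k - c)) \<cdot>\<^sub>m (C * D)) (- C) (0\<^sub>m l n) ?B"
    unfolding CY[symmetric] BY[symmetric]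
    using A B C D by (subst mult_four_block_mat[of _ n n _ l _ l]) auto
  have "det (?N * ?U) = det (?A - (1 / (k - c)) \<cdot>\<^sub>m (C * D)) * det ?B"
    unfolding NU
    by (rule det_four_block_mat_lower_left_zero[of _ n _ l]) (use A B C D in auto)
  moreover have "det ?U = 1"
    using D by (subst det_four_block_mat_upper_right_zero[of _ n _ l]) auto
  ultimately show ?thesis
    using N U by (simp add: det_mult poly_char_poly_eq_det[OF M] poly_char_poly_eq_det[OF B] kN)
qed

text \<open>
  For \<open>t \<noteq> 0\<close> the determinant is the value of the homogenized characteristic polynomial of \<open>A\<close> at
  \<open>(p, t)\<close>.  The value \<open>t = 0\<close> cannot be excluded: the pencil of a corona may degenerate for special
  \<open>k\<close>, and for all \<open>k\<close> when \<open>\<alpha> = 1\<close>.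
\<close>

lemma det_pencil_cong:
  fixes A1 A2 :: "'a :: field mat"
  assumes A1: "A1 \<in> carrier_mat n n" and A2: "A2 \<in> carrier_mat n n"
    and "char_poly A1 = char_poly A2"
  shows "det (p \<cdot>\<^sub>m 1\<^sub>m n - t \<cdot>\<^sub>m A1) = det (p \<cdot>\<^sub>m 1\<^sub>m n - t \<cdot>\<^sub>m A2)"
proof (cases "t = 0")
  case True
  have "p \<cdot>\<^sub>m 1\<^sub>m n - t \<cdot>\<^sub>m A1 = p \<cdot>\<^sub>m 1\<^sub>m n - t \<cdot>\<^sub>m A2"
    by (rule eq_matI) (use True A1 A2 in auto)
  then show ?thesis by simp
next
  case False
  have "det (p \<cdot>\<^sub>m 1\<^sub>m n - t \<cdot>\<^sub>m A) = t ^ n * poly (char_poly A) (p / t)"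
    if A: "A \<in> carrier_mat n n" for A
  proof -
    have "p \<cdot>\<^sub>m 1\<^sub>m n - t \<cdot>\<^sub>m A = t \<cdot>\<^sub>m ((p / t) \<cdot>\<^sub>m 1\<^sub>m n - A)"
      by (rule eq_matI) (use False A in \<open>auto simp: field_simps\<close>)
    then show ?thesis
      using A by (simp add: poly_char_poly_eq_det)
  qed
  then show ?thesis
    using assms by simp
qed

lemma poly_eqI_cofinite:
  fixes p q :: "'a :: {idom, ring_char_0} poly"
  assumes "finite S" and "\<And>x. x \<notin> S \<Longrightarrow> poly p x = poly q x"
  shows "p = q"
proof (rule ccontr)
  assume "p \<noteq> q"
  then have "finite {x. poly (p - q) x = 0}"
    by (intro poly_roots_finite) simp
  moreover have "- S \<subseteq> {x. poly (p - q) x = 0}"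
    using assms(2) by auto
  ultimately have "finite (S \<union> - S)"
    using assms(1) finite_subset by blast
  then show False
    using infinite_UNIV_char_0[where 'a = 'a] by (simp add: Compl_partition)
qed

text \<open>
  The characteristic polynomial is monic and splits over the complex numbers, so its roots with their
  multiplicities give it back.
\<close>

lemma eigenvalue_mset_eq_iff:
  assumes A: "A \<in> carrier_mat n n" and B: "B \<in> carrier_mat l l"
  shows "eigenvalue_mset A = eigenvalue_mset B \<longleftrightarrow> char_poly A = char_poly B"
proof -
  have split: "char_poly M = (\<Prod>a\<in>#proots (char_poly M). [:- a, 1:])"
    if "M \<in> carrier_mat d d" for M :: "complex mat" and d
  proof -
    obtain as where "char_poly M = (\<Prod>a\<leftarrow>as. [:- a, 1:])"
      using char_poly_factorized[OF \<open>M \<in> carrier_mat d d\<close>] by blast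
    moreover have "proots (\<Prod>a\<leftarrow>as. [:- a, 1:]) = mset as"
    proof (induction as)
      case (Cons a as)
      have "(\<Prod>a\<leftarrow>as. [:- a, 1:]) \<noteq> 0"
        by (simp add: prod_list_zero_iff image_iff)
      then have "proots ([:- a, 1:] * (\<Prod>a\<leftarrow>as. [:- a, 1:])) = add_mset a (mset as)"
        using Cons.IH by (subst proots_mult) auto
      then show ?case
        by (simp only: list.map prod_list.Cons mset.simps)
    qed simp
    ultimately show ?thesis
      by (metis mset_map prod_mset_prod_list)
  qed
  have "eigenvalue_mset A = eigenvalue_mset B \<longleftrightarrow>
      char_poly (map_mat complex_of_real A) = char_poly (map_mat complex_of_real B)"
    unfolding eigenvalue_mset_def
    using split[of "map_mat complex_of_real A" n] split[of "map_mat complex_of_real B" l] A B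
    by (metis map_carrier_mat)
  also have "\<dots> \<longleftrightarrow> char_poly A = char_poly B"
    using A B by (simp add: of_real_hom.char_poly_hom poly_eq_iff coeff_map_poly)
  finally show ?thesis .
qed

lemma sum_nth_distinct:
  assumes "distinct xs"
  shows "(\<Sum>i = 0..<length xs. f (xs ! i)) = sum f (set xs)"
proof -
  have "sum f (set xs) = sum_list (map f xs)"
    using assms by (simp add: sum_list_distinct_conv_sum_set)
  then show ?thesis
    by (simp add: sum_list_sum_nth)
qed

section \<open>Vertex degrees\<close>

lemma bij_betw_obtains:
  assumes "bij_betw f A B" "y \<in> B"
  obtains x where "x \<in> A" "f x = y"
  using assms by (auto simp: bij_betw_def)

lemma vdegree_eq_card_neighbours:
  assumes "simple_graph G"
  shows "vdegree G v = card {u \<in> verts G. {v, u} \<in> edges G}"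
proof -
  have "bij_betw (\<lambda>u. {v, u}) {u \<in> verts G. {v, u} \<in> edges G} {d \<in> edges G. v \<in> d}"
  proof (rule bij_betwI')
    fix d assume "d \<in> {d \<in> edges G. v \<in> d}"
    moreover from this obtain u where "d = {v, u}"
      using assms unfolding simple_graph_def card_2_iff by fastforce
    ultimately show "\<exists>u\<in>{u \<in> verts G. {v, u} \<in> edges G}. d = {v, u}"
      using assms by (intro bexI[of _ u]) (auto simp: simple_graph_def)
  qed (auto simp: doubleton_eq_iff)
  from bij_betw_same_card[OF this] show ?thesis
    by (simp add: vdegree_def)
qed

lemma simple_graph_loopless: "simple_graph G \<Longrightarrow> {v} \<notin> edges G"
  by (auto simp: simple_graph_def)

lemma vdegree_less_order:
  assumes "simple_graph G" "v \<in> verts G"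
  shows "vdegree G v < card (verts G)"
proof -
  have "{u \<in> verts G. {v, u} \<in> edges G} \<subset> verts G"
    using assms simple_graph_loopless[of G v] by force
  then show ?thesis
    unfolding vdegree_eq_card_neighbours[OF assms(1)]
    using assms(1) by (intro psubset_card_mono) (auto simp: simple_graph_def)
qed

lemma vdegree_isomorphism:
  assumes "simple_graph G" "simple_graph G'" "bij_betw f (verts G) (verts G')"
    and adj: "\<And>u v. u \<in> verts G \<Longrightarrow> v \<in> verts G \<Longrightarrow> {u, v} \<in> edges G \<longleftrightarrow> {f u, f v} \<in> edges G'"
    and v: "v \<in> verts G"
  shows "vdegree G' (f v) = vdegree G v"
proof -
  have "f ` {u \<in> verts G. {v, u} \<in> edges G} = {w \<in> verts G'. {f v, w} \<in> edges G'}"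
    using assms(3) adj[OF v] by (fastforce simp: bij_betw_def)
  moreover have "card (f ` {u \<in> verts G. {v, u} \<in> edges G}) = card {u \<in> verts G. {v, u} \<in> edges G}"
    by (rule card_image, rule inj_on_subset[OF bij_betw_imp_inj_on[OF assms(3)]]) blast
  ultimately show ?thesis
    by (simp only: vdegree_eq_card_neighbours[OF assms(1)] vdegree_eq_card_neighbours[OF assms(2)])
qed

section \<open>Adjacency and degrees in an edge corona\<close>

locale regular_edge_corona =
  fixes G :: "'a ugraph" and r m :: nat and e :: "nat \<Rightarrow> 'a set"
    and H :: "nat \<Rightarrow> 'c ugraph" and s q :: nat
  assumes G: "simple_graph G" and G_regular: "regular_graph r G"
    and e: "bij_betw e {1..m} (edges G)"
    and H: "\<And>i. i \<in> {1..m} \<Longrightarrow> simple_graph (H i)"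
    and H_regular: "\<And>i. i \<in> {1..m} \<Longrightarrow> regular_graph s (H i)"
    and H_order: "\<And>i. i \<in> {1..m} \<Longrightarrow> card (verts (H i)) = q"
begin

abbreviation corona where "corona \<equiv> gen_edge_corona G m e H"
abbreviation copy_verts where "copy_verts \<equiv> SIGMA i:{1..m}. verts (H i)"

lemma simple_corona: "simple_graph corona"
  using simple_graph_gen_edge_corona[OF G e H] .

lemma finite_copy_verts: "finite copy_verts"
  using H by (auto simp: simple_graph_def)

lemma verts_corona: "verts corona = verts G <+> copy_verts"
  by (simp add: gen_edge_corona_def)

lemma edge_mem: "i \<in> {1..m} \<Longrightarrow> e i \<in> edges G"
  using e by (auto simp: bij_betw_def)

lemma edge_coronaE:
  assumes "d \<in> edges corona"
  obtains d' where "d = Inl ` d'" "d' \<in> edges G"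
  | i d' where "d = (\<lambda>x. Inr (i, x)) ` d'" "i \<in> {1..m}" "d' \<in> edges (H i)"
  | i u x where "d = {Inl u, Inr (i, x)}" "i \<in> {1..m}" "u \<in> e i" "x \<in> verts (H i)"
  using assms by (auto simp: gen_edge_corona_def)

lemma adj_Inl_Inl: "{Inl u, Inl v} \<in> edges corona \<longleftrightarrow> {u, v} \<in> edges G"
proof
  assume "{Inl u, Inl v} \<in> edges corona"
  then show "{u, v} \<in> edges G"
  proof (cases rule: edge_coronaE)
    case (1 d')
    then have "(Inl ` {u, v} :: ('a + nat \<times> 'c) set) = Inl ` d'" by simp
    then show ?thesis
      using 1 by (simp only: inj_image_eq_iff[OF inj_Inl])
  next
    case (2 i d')
    then have "(Inl u :: 'a + nat \<times> 'c) \<in> (\<lambda>x. Inr (i, x)) ` d'" by (metis insertI1)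
    then show ?thesis by auto
  qed (auto simp: doubleton_eq_iff)
next
  assume "{u, v} \<in> edges G"
  moreover have "{Inl u, Inl v} = Inl ` {u, v}" by simp
  ultimately show "{Inl u, Inl v} \<in> edges corona"
    unfolding gen_edge_corona_def ugraph.simps by blast
qed

lemma adj_Inl_Inr:
  "{Inl u, Inr (i, x)} \<in> edges corona \<longleftrightarrow> i \<in> {1..m} \<and> u \<in> e i \<and> x \<in> verts (H i)"
proof
  assume "{Inl u, Inr (i, x)} \<in> edges corona"
  then show "i \<in> {1..m} \<and> u \<in> e i \<and> x \<in> verts (H i)"
  proof (cases rule: edge_coronaE)
    case (1 d')
    then have "(Inr (i, x) :: 'a + nat \<times> 'c) \<in> Inl ` d'" by (metis insertI1 insert_commute)
    then show ?thesis by auto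
  next
    case (2 i d')
    then have "(Inl u :: 'a + nat \<times> 'c) \<in> (\<lambda>x. Inr (i, x)) ` d'" by (metis insertI1)
    then show ?thesis by auto
  qed (auto simp: doubleton_eq_iff)
next
  assume "i \<in> {1..m} \<and> u \<in> e i \<and> x \<in> verts (H i)"
  then show "{Inl u, Inr (i, x)} \<in> edges corona"
    unfolding gen_edge_corona_def ugraph.simps by blast
qed

lemma adj_Inr_Inr:
  "{Inr (i, x), Inr (j, y)} \<in> edges corona \<longleftrightarrow> i \<in> {1..m} \<and> i = j \<and> {x, y} \<in> edges (H i)"
proof
  assume "{Inr (i, x), Inr (j, y)} \<in> edges corona"
  then show "i \<in> {1..m} \<and> i = j \<and> {x, y} \<in> edges (H i)"
  proof (cases rule: edge_coronaE)
    case (1 d')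
    then have "(Inr (i, x) :: 'a + nat \<times> 'c) \<in> Inl ` d'" by (metis insertI1)
    then show ?thesis by auto
  next
    case (2 k d')
    have "(Inr (i, x) :: 'a + nat \<times> 'c) \<in> (\<lambda>x. Inr (k, x)) ` d'" "(Inr (j, y) :: 'a + nat \<times> 'c) \<in> (\<lambda>x. Inr (k, x)) ` d'"
      unfolding 2(1)[symmetric] by simp_all
    then have k: "i = k" "j = k" by auto
    have "inj (\<lambda>x. Inr (k, x) :: 'a + nat \<times> 'c)" by (rule injI) simp
    moreover have "(\<lambda>x. Inr (k, x) :: 'a + nat \<times> 'c) ` {x, y} = (\<lambda>x. Inr (k, x)) ` d'"
      using 2(1) k by simp
    ultimately have "{x, y} = d'"
      by (rule inj_image_eq_iff[THEN iffD1])
    then show ?thesis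
      using 2 k by simp
  qed (auto simp: doubleton_eq_iff)
next
  assume a: "i \<in> {1..m} \<and> i = j \<and> {x, y} \<in> edges (H i)"
  then have "{Inr (i, x), Inr (j, y)} = (\<lambda>x. Inr (i, x)) ` {x, y}" by simp
  then show "{Inr (i, x), Inr (j, y)} \<in> edges corona"
    unfolding gen_edge_corona_def ugraph.simps using a by blast
qed

text \<open>
  The next two counts are the entries of \<open>R R\<^sup>T = A(G) + r I\<close> for the vertex-edge incidence matrix \<open>R\<close>
  of \<open>G\<close>: two different vertices lie on a common edge exactly if they are adjacent, and
  then on just one.
\<close>

lemma card_incident:
  assumes "v \<in> verts G"
  shows "card {i \<in> {1..m}. v \<in> e i} = r"
proof -
  have "e ` {i \<in> {1..m}. v \<in> e i} = {d \<in> edges G. v \<in> d}"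
    unfolding bij_betw_imp_surj_on[OF e, symmetric] by blast
  then have "bij_betw e {i \<in> {1..m}. v \<in> e i} {d \<in> edges G. v \<in> d}"
    by (intro bij_betw_subset[OF e]) auto
  from bij_betw_same_card[OF this] show ?thesis
    using G_regular assms by (simp add: regular_graph_def vdegree_def)
qed

lemma card_common_incident:
  assumes "v \<in> verts G" "w \<in> verts G"
  shows "card {i \<in> {1..m}. v \<in> e i \<and> w \<in> e i} =
    (if v = w then r else if {v, w} \<in> edges G then 1 else 0)"
proof (cases "v = w")
  case True
  then show ?thesis using card_incident[OF assms(1)] by simp
next
  case False
  have iff: "v \<in> e i \<and> w \<in> e i \<longleftrightarrow> e i = {v, w}" if i: "i \<in> {1..m}" for i
  proof -
    have "card (e i) = 2"
      using edge_mem[OF i] G by (auto simp: simple_graph_def)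
    then show ?thesis
      using False by (auto simp: card_2_iff)
  qed
  have "{i \<in> {1..m}. v \<in> e i \<and> w \<in> e i} = {i \<in> {1..m}. e i = {v, w}}"
    using iff by blast
  moreover have "card {i \<in> {1..m}. e i = {v, w}} = 1" if "{v, w} \<in> edges G"
  proof -
    from bij_betw_obtains[OF e that] obtain i where i: "i \<in> {1..m}" "e i = {v, w}" .
    have "j = i" if "j \<in> {1..m}" "e j = {v, w}" for j
      using e i that by (metis bij_betw_imp_inj_on inj_onD)
    then have "{i \<in> {1..m}. e i = {v, w}} = {i}"
      using i by blast
    then show ?thesis by simp
  qed
  moreover have "{i \<in> {1..m}. e i = {v, w}} = {}" if "{v, w} \<notin> edges G"
    using that edge_mem by fastforce
  ultimately show ?thesis
    using False by (simp del: Collect_empty_eq)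
qed

lemma card_copies:
  assumes "I \<subseteq> {1..m}"
  shows "card (SIGMA i:I. verts (H i)) = card I * q"
proof -
  have "card (SIGMA i:I. verts (H i)) = (\<Sum>i\<in>I. card (verts (H i)))"
    using assms H finite_subset[OF assms]
    by (intro card_SigmaI) (auto simp: simple_graph_def)
  also have "\<dots> = (\<Sum>i\<in>I. q)"
    using assms H_order by (intro sum.cong) auto
  finally show ?thesis by simp
qed

lemma vdegree_Inl:
  assumes v: "v \<in> verts G"
  shows "vdegree corona (Inl v) = r * (q + 1)"
proof -
  let ?I = "{i \<in> {1..m}. v \<in> e i}"
  have "{u \<in> verts corona. {Inl v, u} \<in> edges corona} =
      {u \<in> verts G. {v, u} \<in> edges G} <+> (SIGMA i:?I. verts (H i))"
    by (auto simp: verts_corona adj_Inl_Inl adj_Inl_Inr)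
  moreover have "card (SIGMA i:?I. verts (H i)) = r * q"
    by (subst card_copies) (blast, simp only: card_incident[OF v])
  moreover have "finite (SIGMA i:?I. verts (H i))"
    by (rule finite_subset[OF _ finite_copy_verts]) auto
  moreover have "card {u \<in> verts G. {v, u} \<in> edges G} = r"
    using vdegree_eq_card_neighbours[OF G] G_regular v by (simp add: regular_graph_def)
  moreover have "finite {u \<in> verts G. {v, u} \<in> edges G}"
    using G by (auto simp: simple_graph_def)
  ultimately show ?thesis
    using vdegree_eq_card_neighbours[OF simple_corona] by (simp add: card_Plus)
qed

lemma card_neighbours_H:
  assumes "i \<in> {1..m}" "x \<in> verts (H i)"
  shows "card {y \<in> verts (H i). {x, y} \<in> edges (H i)} = s"
  using vdegree_eq_card_neighbours[OF H] H_regular assms by (simp add: regular_graph_def)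

lemma vdegree_Inr:
  assumes "i \<in> {1..m}" "x \<in> verts (H i)"
  shows "vdegree corona (Inr (i, x)) = s + 2"
proof -
  have *: "{Inr (i, x), Inl v} \<in> edges corona \<longleftrightarrow> v \<in> e i" for v
    using adj_Inl_Inr assms by (simp add: insert_commute)
  have ei: "e i \<subseteq> verts G" "card (e i) = 2"
    using edge_mem[OF assms(1)] G by (auto simp: simple_graph_def)
  have "{u \<in> verts corona. {Inr (i, x), u} \<in> edges corona} =
      e i <+> Pair i ` {y \<in> verts (H i). {x, y} \<in> edges (H i)}"
    using ei(1) assms(1) by (auto simp: verts_corona adj_Inr_Inr *)
  moreover have "finite (verts (H i))" "finite (e i)"
    using H[OF assms(1)] ei by (auto simp: simple_graph_def intro: card_ge_0_finite)
  ultimately show ?thesis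
    using vdegree_eq_card_neighbours[OF simple_corona] card_neighbours_H[OF assms] ei
    by (simp add: card_Plus card_image inj_on_def)
qed

end

section \<open>The spectrum of an edge corona\<close>

text \<open>
  The rows and columns that belong to the copies.  The base graph contributes to it only the
  summand \<open>2\<close> of every degree (the two ends of an edge), so the same block arises for both base graphs.
  It is defined outside the locale in order to make this independence visible.
\<close>

definition copies_block ::
  "real \<Rightarrow> nat \<Rightarrow> (nat \<Rightarrow> 'c ugraph) \<Rightarrow> (nat \<times> 'c) list \<Rightarrow> real mat" where
  "copies_block \<alpha> s H ws = mat (length ws) (length ws) (\<lambda>(a, b).
     (if ws ! a = ws ! b then \<alpha> * (s + 2) else 0) +
     (if fst (ws ! a) = fst (ws ! b) \<and> {snd (ws ! a), snd (ws ! b)} \<in> edges (H (fst (ws ! a)))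
      then 1 - \<alpha> else 0))"

context regular_edge_corona
begin

definition incidence_block :: "real \<Rightarrow> 'a list \<Rightarrow> (nat \<times> 'c) list \<Rightarrow> real mat" where
  "incidence_block \<alpha> vs ws = mat (length ws) (length vs)
     (\<lambda>(a, b). if vs ! b \<in> e (fst (ws ! a)) then 1 - \<alpha> else 0)"

context
  fixes \<alpha> :: real and vs :: "'a list" and ws :: "(nat \<times> 'c) list"
  assumes vs: "distinct vs" "set vs = verts G" and ws: "distinct ws" "set ws = copy_verts"
begin

lemma vs_nth: "a < length vs \<Longrightarrow> vs ! a \<in> verts G"
  using vs nth_mem by blast

lemma sum_ws: "(\<Sum>k = 0..<length ws. f (ws ! k)) = sum f copy_verts"
  using sum_nth_distinct[OF ws(1), of f] by (simp only: ws(2))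

lemma ws_nth: "a < length ws \<Longrightarrow> fst (ws ! a) \<in> {1..m} \<and> snd (ws ! a) \<in> verts (H (fst (ws ! a)))"
  using ws nth_mem[of a ws] by auto

lemma A_alpha_mat_corona:
  "A_alpha_mat \<alpha> (map Inl vs @ map Inr ws) corona =
    four_block_mat ((\<alpha> * r * (q + 1)) \<cdot>\<^sub>m 1\<^sub>m (length vs) + (1 - \<alpha>) \<cdot>\<^sub>m adj_mat vs G)
      ((incidence_block \<alpha> vs ws)\<^sup>T) (incidence_block \<alpha> vs ws) (copies_block \<alpha> s H ws)" (is "?L = ?R")
proof (rule eq_matI)
  fix a b assume "a < dim_row ?R" "b < dim_col ?R"
  then have ab: "a < length vs + length ws" "b < length vs + length ws"
    by (auto simp: adj_mat_def copies_block_def)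
  note [simp] = A_alpha_mat_def deg_mat_def adj_mat_def copies_block_def incidence_block_def nth_append
  show "?L $$ (a, b) = ?R $$ (a, b)"
  proof (cases "a < length vs"; cases "b < length vs")
    assume "a < length vs" "b < length vs"
    then show ?thesis
      using vs_nth by (auto simp: adj_Inl_Inl vdegree_Inl algebra_simps)
  next
    assume h: "a < length vs" "\<not> b < length vs"
    obtain i x where "ws ! (b - length vs) = (i, x)" by fastforce
    then show ?thesis
      using h ab ws_nth[of "b - length vs"] by (auto simp: adj_Inl_Inr)
  next
    assume h: "\<not> a < length vs" "b < length vs"
    obtain i x where "ws ! (a - length vs) = (i, x)" by fastforce
    then show ?thesis
      using h ab ws_nth[of "a - length vs"]
      by (auto simp: adj_Inl_Inr insert_commute[of "Inr _"])
  next
    assume h: "\<not> a < length vs" "\<not> b < length vs"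
    obtain i x where a: "ws ! (a - length vs) = (i, x)" by fastforce
    obtain j y where b: "ws ! (b - length vs) = (j, y)" by fastforce
    have "(i, x) = (j, y) \<longleftrightarrow> a = b"
      using a b h ab ws(1) nth_eq_iff_index_eq[OF ws(1), of "a - length vs" "b - length vs"] by auto
    then show ?thesis
      using a b h ab ws_nth[of "a - length vs"] ws_nth[of "b - length vs"]
      by (auto simp: adj_Inr_Inr vdegree_Inr)
  qed
qed (auto simp: A_alpha_mat_def deg_mat_def adj_mat_def copies_block_def)

text \<open>
  A row of the left factor that belongs to a vertex of \<open>H i\<close> meets the column of \<open>v\<close> only inside the
  \<open>i\<close>-th copy, where this column is constant; the row sum there is \<open>c\<close> because \<open>H i\<close> is \<open>s\<close>-regular.
\<close>

lemma copies_block_mult: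
  "copies_block \<alpha> s H ws * incidence_block \<alpha> vs ws = (\<alpha> * (s + 2) + (1 - \<alpha>) * s) \<cdot>\<^sub>m incidence_block \<alpha> vs ws"
  (is "?L = ?R")
proof (rule eq_matI)
  fix a b assume "a < dim_row ?R" "b < dim_col ?R"
  then have ab: "a < length ws" "b < length vs" by (auto simp: incidence_block_def)
  obtain i x where a: "ws ! a = (i, x)" by fastforce
  have i: "i \<in> {1..m}" "x \<in> verts (H i)" using ws_nth[OF ab(1)] a by auto
  let ?d = "if vs ! b \<in> e i then 1 - \<alpha> else 0"
  let ?N = "{y \<in> verts (H i). {x, y} \<in> edges (H i)}"
  let ?f = "\<lambda>u. (if (i, x) = u then \<alpha> * (s + 2) * ?d else 0) + (if u \<in> Pair i ` ?N then (1 - \<alpha>) * ?d else 0)"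
  let ?g = "\<lambda>u. ((if (i, x) = u then \<alpha> * (s + 2) else 0) +
       (if i = fst u \<and> {x, snd u} \<in> edges (H i) then 1 - \<alpha> else 0)) *
      (if vs ! b \<in> e (fst u) then 1 - \<alpha> else 0)"
  have gf: "?g u = ?f u" if "u \<in> copy_verts" for u
  proof (cases u)
    case (Pair j y)
    show ?thesis
    proof (cases "i = j")
      case True
      have "u \<in> Pair i ` ?N \<longleftrightarrow> {x, y} \<in> edges (H i)"
        using that Pair True by auto
      then show ?thesis
        using Pair True by (simp add: distrib_right)
    next
      case False
      then have "u \<notin> Pair i ` ?N" using Pair by auto
      then show ?thesis
        using Pair False by simp
    qed
  qed
  (* ?g is the summand as it comes from the matrix product; ?f has the column entry evaluated in
     the i-th copy and splits off the diagonal *)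
  have "?L $$ (a, b) = (\<Sum>k = 0..<length ws. ?g (ws ! k))"
    using ab a by (simp add: copies_block_def incidence_block_def scalar_prod_def)
  also have "\<dots> = (\<Sum>u\<in>copy_verts. ?g u)"
    by (rule sum_ws)
  also have "\<dots> = (\<Sum>u\<in>copy_verts. ?f u)"
    by (rule sum.cong[OF refl gf])
  also have "\<dots> = \<alpha> * (s + 2) * ?d + (\<Sum>u\<in>copy_verts. if u \<in> Pair i ` ?N then (1 - \<alpha>) * ?d else 0)"
    using finite_copy_verts i by (simp add: sum.distrib)
  also have "(\<Sum>u\<in>copy_verts. if u \<in> Pair i ` ?N then (1 - \<alpha>) * ?d else 0) =
      (\<Sum>u\<in>copy_verts \<inter> Pair i ` ?N. (1 - \<alpha>) * ?d)"
    using finite_copy_verts by (subst sum.inter_restrict) auto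
  also have "copy_verts \<inter> Pair i ` ?N = Pair i ` ?N"
    using i by auto
  also have "(\<Sum>u\<in>Pair i ` ?N. (1 - \<alpha>) * ?d) = s * ((1 - \<alpha>) * ?d)"
    using card_neighbours_H[OF i] by (simp add: card_image inj_on_def)
  finally show "?L $$ (a, b) = ?R $$ (a, b)"
    using ab a by (simp add: incidence_block_def algebra_simps)
qed (auto simp: copies_block_def incidence_block_def)

text \<open>
  The rows of the block that belong to one edge are equal.  Because every edge has the same number
  \<open>q\<close> of them, they all enter the product with the same weight, and \<open>R R\<^sup>T\<close> comes out.
\<close>

lemma transpose_incidence_block_mult:
  "(incidence_block \<alpha> vs ws)\<^sup>T * incidence_block \<alpha> vs ws =
    ((1 - \<alpha>)\<^sup>2 * q) \<cdot>\<^sub>m (adj_mat vs G + real r \<cdot>\<^sub>m 1\<^sub>m (length vs))" (is "?L = ?R")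
proof (rule eq_matI)
  fix a b assume "a < dim_row ?R" "b < dim_col ?R"
  then have ab: "a < length vs" "b < length vs" by (auto simp: adj_mat_def)
  let ?I = "{i \<in> {1..m}. vs ! a \<in> e i \<and> vs ! b \<in> e i}"
  have "?L $$ (a, b) = (\<Sum>k = 0..<length ws.
      (if vs ! a \<in> e (fst (ws ! k)) then 1 - \<alpha> else 0) *
      (if vs ! b \<in> e (fst (ws ! k)) then 1 - \<alpha> else 0))"
    using ab by (simp add: incidence_block_def scalar_prod_def)
  also have "\<dots> = (\<Sum>k = 0..<length ws. (\<lambda>u. if fst u \<in> ?I then (1 - \<alpha>)\<^sup>2 else 0) (ws ! k))"
    using ws_nth by (intro sum.cong refl) (auto simp: power2_eq_square)
  also have "\<dots> = (\<Sum>u\<in>copy_verts. if fst u \<in> ?I then (1 - \<alpha>)\<^sup>2 else 0)"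
    by (rule sum_ws[of "\<lambda>u. if fst u \<in> ?I then (1 - \<alpha>)\<^sup>2 else 0"])
  also have "\<dots> = (\<Sum>u\<in>copy_verts \<inter> {u. fst u \<in> ?I}. (1 - \<alpha>)\<^sup>2)"
    using finite_copy_verts by (subst sum.inter_restrict) auto
  also have "copy_verts \<inter> {u. fst u \<in> ?I} = (SIGMA i:?I. verts (H i))"
    by auto
  also have "(\<Sum>u\<in>(SIGMA i:?I. verts (H i)). (1 - \<alpha>)\<^sup>2) = real (card ?I * q) * (1 - \<alpha>)\<^sup>2"
    by (simp only: sum_constant, subst card_copies) (blast, simp)
  also have "card ?I = (if a = b then r else if {vs ! a, vs ! b} \<in> edges G then 1 else 0)"
    using card_common_incident[OF vs_nth vs_nth, OF ab] nth_eq_iff_index_eq[OF vs(1) ab] by simp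
  finally show "?L $$ (a, b) = ?R $$ (a, b)"
    using ab simple_graph_loopless[OF G] by (auto simp: adj_mat_def)
qed (auto simp: adj_mat_def incidence_block_def)

lemma poly_char_poly_corona:
  assumes k: "k \<noteq> \<alpha> * (s + 2) + (1 - \<alpha>) * s"
  defines "w \<equiv> (1 - \<alpha>)\<^sup>2 * q / (k - (\<alpha> * (s + 2) + (1 - \<alpha>) * s))"
  shows "poly (char_poly (A_alpha_mat \<alpha> (map Inl vs @ map Inr ws) corona)) k =
    det ((k - \<alpha> * r * (q + 1) - w * r) \<cdot>\<^sub>m 1\<^sub>m (length vs) - (1 - \<alpha> + w) \<cdot>\<^sub>m adj_mat vs G) *
    poly (char_poly (copies_block \<alpha> s H ws)) k"
proof -
  let ?n = "length vs" and ?c = "\<alpha> * (s + 2) + (1 - \<alpha>) * s"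
  let ?A = "(\<alpha> * r * (q + 1)) \<cdot>\<^sub>m 1\<^sub>m ?n + (1 - \<alpha>) \<cdot>\<^sub>m adj_mat vs G"
  have "k \<cdot>\<^sub>m 1\<^sub>m ?n - ?A - (1 / (k - ?c)) \<cdot>\<^sub>m ((incidence_block \<alpha> vs ws)\<^sup>T * incidence_block \<alpha> vs ws) =
      (k - \<alpha> * r * (q + 1) - w * r) \<cdot>\<^sub>m 1\<^sub>m ?n - (1 - \<alpha> + w) \<cdot>\<^sub>m adj_mat vs G"
    unfolding transpose_incidence_block_mult
    by (rule eq_matI) (auto simp: adj_mat_def w_def algebra_simps add_divide_distrib)
  then show ?thesis
    unfolding A_alpha_mat_corona
    by (subst char_poly_four_block_mat[OF _ _ _ _ copies_block_mult k, of _ ?n])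
      (auto simp: adj_mat_def incidence_block_def copies_block_def)
qed

lemma A_alpha_spectrum_corona:
  "A_alpha_spectrum \<alpha> corona =
    eigenvalue_mset (A_alpha_mat \<alpha> (map Inl vs @ map Inr ws) corona)"
  by (rule A_alpha_spectrum_listing[OF simple_corona])
    (use vs ws in \<open>auto simp: gen_edge_corona_def distinct_map\<close>)

end
end

text \<open>
  The factorization is available at every \<open>k\<close> but one, which is enough to identify the
  characteristic polynomials.
\<close>

lemma corona_A_alpha_spectrum_eq:
  assumes "regular_edge_corona G1 r m e1 H s q" and "regular_edge_corona G2 r m e2 H s q"
    and order: "card (verts G1) = card (verts G2)"
    and spec: "A_spectrum G1 = A_spectrum G2"
  shows "A_alpha_spectrum \<alpha> (gen_edge_corona G1 m e1 H) =
    A_alpha_spectrum \<alpha> (gen_edge_corona G2 m e2 H)"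
proof -
  interpret C1: regular_edge_corona G1 r m e1 H s q by fact
  interpret C2: regular_edge_corona G2 r m e2 H s q by fact
  obtain vs1 where vs1: "distinct vs1" "set vs1 = verts G1"
    using C1.G finite_distinct_list unfolding simple_graph_def by metis
  obtain vs2 where vs2: "distinct vs2" "set vs2 = verts G2"
    using C2.G finite_distinct_list unfolding simple_graph_def by metis
  obtain ws where ws: "distinct ws" "set ws = C1.copy_verts"
    using C1.finite_copy_verts finite_distinct_list by metis
  define n where "n = length vs1"
  have len: "length vs2 = n"
    using order vs1 vs2 distinct_card n_def by metis
  have adj: "adj_mat vs1 G1 \<in> carrier_mat n n" "adj_mat vs2 G2 \<in> carrier_mat n n"
    by (auto simp: adj_mat_def n_def len)
  have cp: "char_poly (adj_mat vs1 G1) = char_poly (adj_mat vs2 G2)"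
    using spec A_spectrum_listing[OF C1.G vs1] A_spectrum_listing[OF C2.G vs2]
      eigenvalue_mset_eq_iff[OF adj] by simp
  have "char_poly (A_alpha_mat \<alpha> (map Inl vs1 @ map Inr ws) C1.corona) =
      char_poly (A_alpha_mat \<alpha> (map Inl vs2 @ map Inr ws) C2.corona)"
    by (rule poly_eqI_cofinite[of "{\<alpha> * (s + 2) + (1 - \<alpha>) * s}"])
      (simp_all add: C1.poly_char_poly_corona[OF vs1 ws] C2.poly_char_poly_corona[OF vs2 ws]
        len n_def[symmetric] det_pencil_cong[OF adj cp])
  then show ?thesis
    unfolding C1.A_alpha_spectrum_corona[OF vs1 ws] C2.A_alpha_spectrum_corona[OF vs2 ws]
    by (simp add: eigenvalue_mset_def A_alpha_mat_def deg_mat_def adj_mat_def len n_def[symmetric]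
        of_real_hom.char_poly_hom[of _ "n + length ws"])
qed

section \<open>Non-isomorphism\<close>

text \<open>
  For \<open>r = 1\<close> the edges partition the vertex set.  Bijections from the \<open>i\<close>-th edge of one graph to
  the \<open>i\<close>-th edge of the other one, chosen arbitrarily, are glued to an isomorphism.  For \<open>r = 0\<close>
  there are no edges and any bijection of the vertex sets will do; here the equal orders enter.
\<close>

lemma regular_degree_le_1_isomorphic:
  assumes G1: "simple_graph G1" "regular_graph r G1" and G2: "simple_graph G2" "regular_graph r G2"
    and order: "card (verts G1) = card (verts G2)"
    and e1: "bij_betw e1 {1..m} (edges G1)" and e2: "bij_betw e2 {1..m} (edges G2)"
    and r: "r \<le> 1"
  shows "graph_isomorphic G1 G2"
proof (cases "r = 0")
  case True
  have none: "edges G = {}" if "simple_graph G" "regular_graph r G" for G :: "'x ugraph"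
  proof (rule ccontr)
    assume "edges G \<noteq> {}"
    then obtain d where d: "d \<in> edges G" by blast
    then have "d \<subseteq> verts G" "d \<noteq> {}"
      using that(1) by (auto simp: simple_graph_def)
    then obtain v where v: "v \<in> d" "v \<in> verts G"
      by blast
    have "finite (edges G)"
      by (rule finite_subset[of _ "Pow (verts G)"]) (use that(1) in \<open>auto simp: simple_graph_def\<close>)
    then have "vdegree G v \<noteq> 0"
      using d v by (auto simp: vdegree_def)
    then show False
      using that(2) v True by (simp add: regular_graph_def)
  qed
  obtain f where "bij_betw f (verts G1) (verts G2)"
    using G1(1) G2(1) order finite_same_card_bij unfolding simple_graph_def by metis
  then show ?thesis
    using none[OF G1] none[OF G2] by (auto simp: graph_isomorphic_def)
next
  case False
  with r have r: "r = 1" by simp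
  have part: "disjoint_family_on e {1..m} \<and> (\<Union>i\<in>{1..m}. e i) = verts G"
    if G: "simple_graph G" "regular_graph r G" and e: "bij_betw e {1..m} (edges G)"
    for G :: "'x ugraph" and e
  proof -
    have uniq: "\<exists>d. {d \<in> edges G. v \<in> d} = {d}" if "v \<in> verts G" for v
      using G(2) that r by (simp add: regular_graph_def vdegree_def card_1_singleton_iff)
    have "disjoint_family_on e {1..m}"
      unfolding disjoint_family_on_def
    proof (intro ballI impI, rule ccontr)
      fix i j assume ij: "i \<in> {1..m}" "j \<in> {1..m}" "i \<noteq> j" "e i \<inter> e j \<noteq> {}"
      then obtain v where v: "v \<in> e i" "v \<in> e j" by blast
      have mem: "e i \<in> edges G" "e j \<in> edges G"
        using e ij by (auto simp: bij_betw_def)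
      then have "v \<in> verts G"
        using G(1) v by (auto simp: simple_graph_def)
      from uniq[OF this] obtain d where d: "{d \<in> edges G. v \<in> d} = {d}" by (rule exE)
      have "e i \<in> {d}" "e j \<in> {d}"
        unfolding d[symmetric] using mem v by simp_all
      then have "e i = e j" by simp
      then show False
        using inj_onD[OF bij_betw_imp_inj_on[OF e]] ij by blast
    qed
    moreover have "(\<Union>i\<in>{1..m}. e i) = \<Union> (edges G)"
      by (simp only: bij_betw_imp_surj_on[OF e])
    moreover have "\<Union> (edges G) = verts G"
    proof
      show "\<Union> (edges G) \<subseteq> verts G"
        using G(1) by (auto simp: simple_graph_def)
      show "verts G \<subseteq> \<Union> (edges G)"
      proof
        fix v assume "v \<in> verts G"
        from uniq[OF this] obtain d where d: "{d \<in> edges G. v \<in> d} = {d}" by (rule exE)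
        have "d \<in> {d \<in> edges G. v \<in> d}"
          unfolding d by simp
        then show "v \<in> \<Union> (edges G)" by auto
      qed
    qed
    ultimately show ?thesis by simp
  qed
  have "\<exists>g. bij_betw g (e1 i) (e2 i)" if "i \<in> {1..m}" for i
  proof -
    have "card (e1 i) = 2" "card (e2 i) = 2"
      using that e1 e2 G1(1) G2(1) by (auto simp: bij_betw_def simple_graph_def)
    then show ?thesis
      by (intro finite_same_card_bij) (auto intro: card_ge_0_finite)
  qed
  then obtain g where g: "\<And>i. i \<in> {1..m} \<Longrightarrow> bij_betw (g i) (e1 i) (e2 i)" by metis
  define f where "f v = g (THE i. i \<in> {1..m} \<and> v \<in> e1 i) v" for v
  have f_eq: "f v = g i v" if "i \<in> {1..m}" "v \<in> e1 i" for i v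
  proof -
    have "(THE i. i \<in> {1..m} \<and> v \<in> e1 i) = i"
      using that part[OF G1 e1] unfolding disjoint_family_on_def by (intro the_equality) blast+
    then show ?thesis by (simp add: f_def)
  qed
  have f_i: "bij_betw f (e1 i) (e2 i)" if "i \<in> {1..m}" for i
    using g[OF that] f_eq[OF that] by (subst bij_betw_cong[of _ _ "g i"]) auto
  have "bij_betw f (\<Union>i\<in>{1..m}. e1 i) (\<Union>i\<in>{1..m}. e2 i)"
    using f_i part[OF G2 e2] by (intro bij_betw_UNION_disjoint) auto
  then have f: "bij_betw f (verts G1) (verts G2)"
    using part[OF G1 e1] part[OF G2 e2] by simp
  have "{u, v} \<in> edges G1 \<longleftrightarrow> {f u, f v} \<in> edges G2" if uv: "u \<in> verts G1" "v \<in> verts G1" for u v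
  proof
    assume "{u, v} \<in> edges G1"
    from bij_betw_obtains[OF e1 this] obtain i where i: "i \<in> {1..m}" "e1 i = {u, v}" .
    then have "{f u, f v} = e2 i"
      using bij_betw_imp_surj_on[OF f_i[OF i(1)]] by simp
    then show "{f u, f v} \<in> edges G2"
      using bij_betwE[OF e2] i(1) by simp
  next
    assume "{f u, f v} \<in> edges G2"
    from bij_betw_obtains[OF e2 this] obtain i where i: "i \<in> {1..m}" "e2 i = {f u, f v}" .
    have mem: "e1 i \<in> edges G1"
      using bij_betwE[OF e1] i(1) by simp
    then have "e1 i \<subseteq> verts G1"
      using G1(1) by (simp add: simple_graph_def)
    moreover have "f ` e1 i = f ` {u, v}"
      using bij_betw_imp_surj_on[OF f_i[OF i(1)]] i(2) by simp
    ultimately have "e1 i = {u, v}"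
      using inj_on_image_eq_iff[OF bij_betw_imp_inj_on[OF f], of "e1 i" "{u, v}"] uv by simp
    then show "{u, v} \<in> edges G1"
      using mem by simp
  qed
  then show ?thesis
    using f by (auto simp: graph_isomorphic_def)
qed

text \<open>
  The degree recognizes the vertices of the base graph.  This fails for \<open>r = 1\<close> and complete
  graphs \<open>H i\<close>, when the corona is a disjoint union of complete graphs.
\<close>

lemma base_isomorphic_if_corona_isomorphic:
  assumes "regular_edge_corona G1 r m e1 H s q" and "regular_edge_corona G2 r m e2 H s q"
    and r: "2 \<le> r"
    and iso: "graph_isomorphic (gen_edge_corona G1 m e1 H) (gen_edge_corona G2 m e2 H)"
  shows "graph_isomorphic G1 G2"
proof -
  interpret C1: regular_edge_corona G1 r m e1 H s q by fact
  interpret C2: regular_edge_corona G2 r m e2 H s q by fact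
  have less: "s + 2 < r * (q + 1)" if "i \<in> {1..m}" "x \<in> verts (H i)" for i x
  proof -
    have "s < q"
      using vdegree_less_order[OF C1.H] C1.H_regular C1.H_order that
      by (metis regular_graph_def)
    moreover have "2 * (q + 1) \<le> r * (q + 1)"
      using r by (rule mult_le_mono1)
    ultimately show ?thesis by simp
  qed
  obtain f where f: "bij_betw f (verts C1.corona) (verts C2.corona)"
    and adj: "\<And>u v. u \<in> verts C1.corona \<Longrightarrow> v \<in> verts C1.corona \<Longrightarrow>
      {u, v} \<in> edges C1.corona \<longleftrightarrow> {f u, f v} \<in> edges C2.corona"
    using iso unfolding graph_isomorphic_def by metis
  have deg: "vdegree C2.corona (f v) = vdegree C1.corona v" if "v \<in> verts C1.corona" for v
    using vdegree_isomorphism[OF C1.simple_corona C2.simple_corona f adj that] .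
  have base1: "Inl ` verts G1 = {v \<in> verts C1.corona. vdegree C1.corona v = r * (q + 1)}"
    using less by (fastforce simp: C1.verts_corona C1.vdegree_Inl C1.vdegree_Inr)
  have base2: "Inl ` verts G2 = {v \<in> verts C2.corona. vdegree C2.corona v = r * (q + 1)}"
    using less by (fastforce simp: C2.verts_corona C2.vdegree_Inl C2.vdegree_Inr)
  have fbase: "bij_betw f (Inl ` verts G1) (Inl ` verts G2)"
  proof (rule bij_betw_subset[OF f])
    show "f ` Inl ` verts G1 = Inl ` verts G2"
      unfolding base1 base2 bij_betw_imp_surj_on[OF f, symmetric] using deg by auto
  qed (auto simp: C1.verts_corona)
  define h where "h v = projl (f (Inl v))" for v
  have fh: "f (Inl v) = Inl (h v)" if "v \<in> verts G1" for v
    using bij_betwE[OF fbase] that by (auto simp: h_def)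
  have "bij_betw Inl (verts G1) (Inl ` verts G1)" and "bij_betw projl (Inl ` verts G2) (verts G2)"
    by (auto simp: bij_betw_def inj_on_def image_image)
  then have "bij_betw (projl \<circ> (f \<circ> Inl)) (verts G1) (verts G2)"
    using fbase by (blast intro: bij_betw_trans)
  then have "bij_betw h (verts G1) (verts G2)"
    by (simp add: h_def[abs_def] comp_def)
  moreover have "{u, v} \<in> edges G1 \<longleftrightarrow> {h u, h v} \<in> edges G2"
    if "u \<in> verts G1" "v \<in> verts G1" for u v
    using adj[of "Inl u" "Inl v"] that
    by (simp add: C1.verts_corona InlI fh C1.adj_Inl_Inl C2.adj_Inl_Inl)
  ultimately show ?thesis
    by (auto simp: graph_isomorphic_def)
qed

theorem corollary4p2:
  fixes G1 :: "'a ugraph" and G2 :: "'b ugraph" and H :: "nat \<Rightarrow> 'c ugraph"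
    and n m q r1 r2 :: nat and e1 :: "nat \<Rightarrow> 'a set" and e2 :: "nat \<Rightarrow> 'b set" and \<alpha> :: real
  assumes "simple_graph G1" and "simple_graph G2"
    and "regular_graph r1 G1" and "regular_graph r1 G2"
    and "card (verts G1) = n" and "card (verts G2) = n"
    and "card (edges G1) = m" and "card (edges G2) = m"
    and "A_cospectral G1 G2"
    and "bij_betw e1 {1..m} (edges G1)" and "bij_betw e2 {1..m} (edges G2)"
    and "\<And>i. i \<in> {1..m} \<Longrightarrow> simple_graph (H i)"
    and "\<And>i. i \<in> {1..m} \<Longrightarrow> regular_graph r2 (H i)"
    and "\<And>i. i \<in> {1..m} \<Longrightarrow> card (verts (H i)) = q"
    and "0 \<le> \<alpha>" and "\<alpha> \<le> 1"
  shows "A_alpha_cospectral \<alpha> (gen_edge_corona G1 m e1 H) (gen_edge_corona G2 m e2 H)"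
proof -
  have C1: "regular_edge_corona G1 r1 m e1 H r2 q" and C2: "regular_edge_corona G2 r1 m e2 H r2 q"
    using assms by (simp_all add: regular_edge_corona_def)
  have order: "card (verts G1) = card (verts G2)"
    using assms by simp
  have non_iso: "\<not> graph_isomorphic G1 G2" and spec: "A_spectrum G1 = A_spectrum G2"
    using \<open>A_cospectral G1 G2\<close> by (simp_all add: A_cospectral_def)
  have "2 \<le> r1"
  proof (rule ccontr)
    assume "\<not> 2 \<le> r1"
    then have "r1 \<le> 1" by simp
    from regular_degree_le_1_isomorphic[OF assms(1,3,2,4) order assms(10,11) this] non_iso
    show False by contradiction
  qed
  from base_isomorphic_if_corona_isomorphic[OF C1 C2 this] non_iso
  have "\<not> graph_isomorphic (gen_edge_corona G1 m e1 H) (gen_edge_corona G2 m e2 H)"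
    by blast
  then show ?thesis
    using corona_A_alpha_spectrum_eq[OF C1 C2 order spec] by (simp add: A_alpha_cospectral_def)
qed

end
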